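(* Let $k\ge 3$ and let $G=(A\cup B,E)$ be an odd $k$-melon graph, where $(A,B)$ is its bipartition. Then $\mathrm{evc}(G)=\mathrm{vc}(G)$, and the family $\mathcal{U}=\{A,B\}$ is a minimum eternal vertex cover class of $G$.
   Context: For $k\ge1$, a $k$-melon graph is the union of $k$ pairwise internally vertex-disjoint paths, each of length at least $1$, all having the same two distinct endpoints $s$ and $t$; it is odd if every path has odd length (such a graph is connected and bipartite). $\mathrm{vc}(G)$ is the minimum cardinality of a vertex cover of $G$. Eternal vertex cover: for a vertex cover $U$ of $G=(V,E)$ and an edge $e=vw$, a defense of $U$ against the attack on $e$ is a one-to-one map $\phi:U\to V$ with $\phi(u)\in N[u]$ (closed neighborhood) for all $u\in U$ such that $\phi(v)=w$ (with $v\in U$) or $\phi(w)=v$ (with $w\in U$). An eternal vertex cover class is a family $\mathcal{U}$ of vertex covers of $G$ of equal cardinality (its size) such that for every $U\in\mathcal{U}$ and every edge $e$ there is a defense $\phi$ of $U$ against $e$ with $\phi(U)\in\mathcal{U}$. $\mathrm{evc}(G)$ is the minimum size of an eternal vertex cover class; a minimum eternal vertex cover class is one of size $\mathrm{evc}(G)$. *)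

theory Defs
  imports Main
begin

text \<open>
  A finite simple graph is given by its vertex set \<open>V\<close> and its set \<open>E\<close> of two-element
  subsets of \<open>V\<close>. The definitions below are meant for such graphs only.
\<close>

definition simple_graph :: "'a set \<Rightarrow> 'a set set \<Rightarrow> bool" where
  "simple_graph V E \<longleftrightarrow> finite V \<and> (\<forall>e\<in>E. e \<subseteq> V \<and> card e = 2)"

definition bipartition :: "'a set \<Rightarrow> 'a set set \<Rightarrow> 'a set \<Rightarrow> 'a set \<Rightarrow> bool" where
  "bipartition V E A B \<longleftrightarrow>
     A \<union> B = V \<and> A \<inter> B = {} \<and> (\<forall>e\<in>E. \<exists>a\<in>A. \<exists>b\<in>B. e = {a, b})"

text \<open>
  A path is represented by the list of its vertices in order; its length is its number of edges.
\<close>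

definition path_edges :: "'a list \<Rightarrow> 'a set set" where
  "path_edges p = {{p ! i, p ! Suc i} | i. Suc i < length p}"

definition path_length :: "'a list \<Rightarrow> nat" where
  "path_length p = length p - 1"

definition path_between :: "'a \<Rightarrow> 'a \<Rightarrow> 'a list \<Rightarrow> bool" where
  "path_between s t p \<longleftrightarrow> p \<noteq> [] \<and> distinct p \<and> hd p = s \<and> last p = t"

definition internal_vertices :: "'a list \<Rightarrow> 'a set" where
  "internal_vertices p = set p - {hd p, last p}"

definition melon_paths :: "nat \<Rightarrow> 'a \<Rightarrow> 'a \<Rightarrow> 'a list set \<Rightarrow> bool" where
  "melon_paths k s t P \<longleftrightarrow>
     k \<ge> 1 \<and> card P = k \<and> s \<noteq> t \<and>
     (\<forall>p\<in>P. path_between s t p \<and> path_length p \<ge> 1) \<and>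
     (\<forall>p\<in>P. \<forall>q\<in>P. p \<noteq> q \<longrightarrow> internal_vertices p \<inter> internal_vertices q = {})"

definition melon_graph :: "nat \<Rightarrow> 'a set \<Rightarrow> 'a set set \<Rightarrow> bool" where
  "melon_graph k V E \<longleftrightarrow>
     (\<exists>s t P. melon_paths k s t P \<and> V = (\<Union>p\<in>P. set p) \<and> E = (\<Union>p\<in>P. path_edges p))"

definition odd_melon_graph :: "nat \<Rightarrow> 'a set \<Rightarrow> 'a set set \<Rightarrow> bool" where
  "odd_melon_graph k V E \<longleftrightarrow>
     (\<exists>s t P. melon_paths k s t P \<and> (\<forall>p\<in>P. odd (path_length p)) \<and>
        V = (\<Union>p\<in>P. set p) \<and> E = (\<Union>p\<in>P. path_edges p))"

lemma melon_graph_simple: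
  assumes "melon_graph k V E"
  shows "simple_graph V E"
proof -
  obtain s t P where P: "melon_paths k s t P"
    and V: "V = (\<Union>p\<in>P. set p)" and E: "E = (\<Union>p\<in>P. path_edges p)"
    using assms unfolding melon_graph_def by blast
  have "finite P"
    using P unfolding melon_paths_def by (auto intro: card_ge_0_finite)
  then have "finite V"
    unfolding V by simp
  moreover have "e \<subseteq> V \<and> card e = 2" if e: "e \<in> E" for e
  proof -
    obtain p i where p: "p \<in> P" "Suc i < length p" "e = {p ! i, p ! Suc i}"
      using e unfolding E path_edges_def by blast
    have "distinct p"
      using P p(1) unfolding melon_paths_def path_between_def by blast
    then have "p ! i \<noteq> p ! Suc i"
      using p(2) by (simp add: nth_eq_iff_index_eq)
    then show ?thesis
      using p unfolding V by (auto intro!: bexI[of _ p])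
  qed
  ultimately show ?thesis
    unfolding simple_graph_def by blast
qed

lemma odd_melon_graph_imp_melon_graph: "odd_melon_graph k V E \<Longrightarrow> melon_graph k V E"
  unfolding odd_melon_graph_def melon_graph_def by blast

definition vertex_cover :: "'a set \<Rightarrow> 'a set set \<Rightarrow> 'a set \<Rightarrow> bool" where
  "vertex_cover V E U \<longleftrightarrow> U \<subseteq> V \<and> (\<forall>e\<in>E. e \<inter> U \<noteq> {})"

definition vc :: "'a set \<Rightarrow> 'a set set \<Rightarrow> nat" where
  "vc V E = (LEAST n. \<exists>U. vertex_cover V E U \<and> card U = n)"

definition closed_nbhd :: "'a set set \<Rightarrow> 'a \<Rightarrow> 'a set" where
  "closed_nbhd E u = insert u {w. {u, w} \<in> E}"

definition defense :: "'a set \<Rightarrow> 'a set set \<Rightarrow> 'a set \<Rightarrow> 'a \<Rightarrow> 'a \<Rightarrow> ('a \<Rightarrow> 'a) \<Rightarrow> bool" where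
  "defense V E U v w \<phi> \<longleftrightarrow>
     \<phi> ` U \<subseteq> V \<and> inj_on \<phi> U \<and> (\<forall>u\<in>U. \<phi> u \<in> closed_nbhd E u) \<and>
     (v \<in> U \<and> \<phi> v = w \<or> w \<in> U \<and> \<phi> w = v)"

text \<open>
  \<open>evc_class V E \<U> n\<close>: \<open>\<U>\<close> is an eternal vertex cover class of size \<open>n\<close>. The class is
  required to be nonempty; otherwise its size would not be determined.
\<close>

definition evc_class :: "'a set \<Rightarrow> 'a set set \<Rightarrow> 'a set set \<Rightarrow> nat \<Rightarrow> bool" where
  "evc_class V E \<U> n \<longleftrightarrow>
     \<U> \<noteq> {} \<and> (\<forall>U\<in>\<U>. vertex_cover V E U \<and> card U = n) \<and>
     (\<forall>U\<in>\<U>. \<forall>v w. {v, w} \<in> E \<longrightarrow> (\<exists>\<phi>. defense V E U v w \<phi> \<and> \<phi> ` U \<in> \<U>))"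

definition evc :: "'a set \<Rightarrow> 'a set set \<Rightarrow> nat" where
  "evc V E = (LEAST n. \<exists>\<U>. evc_class V E \<U> n)"

definition min_evc_class :: "'a set \<Rightarrow> 'a set set \<Rightarrow> 'a set set \<Rightarrow> bool" where
  "min_evc_class V E \<U> \<longleftrightarrow> evc_class V E \<U> (evc V E)"

end

theory Submission
  imports Defs
begin

text \<open>
  A perfect matching of a bipartite graph moves all guards from one side to the other, and it
  defends each of its own edges. So \<open>{A, B}\<close> is an eternal vertex cover class as soon as every
  edge lies in a perfect matching, and its size is minimum because a vertex cover meets every
  matching edge. In an odd melon graph, pick one path \<open>q\<close>, match the vertices of \<open>q\<close> from end to
  end, and match the internal vertices of every other path among themselves. The edges in even
  position on a path are obtained by choosing that path as \<open>q\<close>, those in odd position by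
  choosing any other path.
\<close>

section \<open>Perfect matchings in bipartite graphs\<close>

definition perfect_matching :: "'a set \<Rightarrow> 'a set set \<Rightarrow> 'a set set \<Rightarrow> bool" where
  "perfect_matching V E M \<longleftrightarrow> M \<subseteq> E \<and> (\<forall>v\<in>V. \<exists>!e. e \<in> M \<and> v \<in> e)"

lemma bipartition_commute: "bipartition V E A B \<Longrightarrow> bipartition V E B A"
  unfolding bipartition_def by (metis Int_commute Un_commute insert_commute)

lemma bipartition_vertex_cover: "bipartition V E A B \<Longrightarrow> vertex_cover V E A"
  unfolding bipartition_def vertex_cover_def by blast

lemma bipartition_edgeD:
  assumes "bipartition V E A B" "{v, w} \<in> E"
  shows "v \<in> A \<and> w \<in> B \<or> v \<in> B \<and> w \<in> A"
  using assms unfolding bipartition_def by (metis doubleton_eq_iff)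

text \<open>Sending each vertex to its partner is an involution, hence injective, and it swaps
  \<open>A\<close> and \<open>B\<close> because every edge crosses. The first conclusion ties
  \<open>m\<close> to the edges of \<open>M\<close>, so that an attacked matching edge is known to
  be crossed.\<close>

lemma perfect_matching_mate:
  assumes bip: "bipartition V E A B" and M: "perfect_matching V E M"
  obtains m where "\<forall>v w. {v, w} \<in> M \<longrightarrow> m v = w" "\<forall>v\<in>V. {v, m v} \<in> E"
    "inj_on m V" "m ` A = B"
proof -
  have V: "V = A \<union> B" and disj: "A \<inter> B = {}"
    using bip unfolding bipartition_def by auto
  have ME: "M \<subseteq> E"
    using M unfolding perfect_matching_def by blast
  have "\<exists>w. {v, w} \<in> M" if "v \<in> V" for v
  proof -
    have "\<exists>!e. e \<in> M \<and> v \<in> e"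
      using M that unfolding perfect_matching_def by simp
    then obtain e where e: "e \<in> M" "v \<in> e"
      by (elim ex1E conjE)
    then obtain a b where "e = {a, b}"
      using ME bip unfolding bipartition_def by (meson subsetD)
    then show ?thesis
      using e by (auto simp: insert_commute)
  qed
  then obtain m where m: "\<And>v. v \<in> V \<Longrightarrow> {v, m v} \<in> M"
    by metis
  \<comment> \<open>Both \<open>{v, w}\<close> and the chosen \<open>{v, m v}\<close> are matching
    edges at \<open>v\<close>, so uniqueness makes them equal.\<close>
  have mate: "m v = w" if "{v, w} \<in> M" for v w
  proof -
    have "v \<in> V"
      using bipartition_edgeD[OF bip, of v w] ME that V by auto
    then have "{v, m v} \<in> M" "\<exists>!e. e \<in> M \<and> v \<in> e"
      using M m unfolding perfect_matching_def by auto
    then have "{v, m v} = {v, w}"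
      using that by (metis insertI1)
    then show ?thesis
      by (metis doubleton_eq_iff)
  qed
  have invol: "m (m v) = v" if "v \<in> V" for v
    using m[OF that] by (subst (asm) insert_commute) (rule mate)
  have AB: "m v \<in> B" if "v \<in> A" for v
    using bipartition_edgeD[OF bip subsetD[OF ME m], of v] V disj that by auto
  have BA: "m v \<in> A" if "v \<in> B" for v
    using bipartition_edgeD[OF bip subsetD[OF ME m], of v] V disj that by auto
  have "m ` A = B"
  proof
    show "m ` A \<subseteq> B"
      using AB by auto
    show "B \<subseteq> m ` A"
      using BA invol V by (metis UnI2 image_eqI subsetI)
  qed
  moreover have "inj_on m V"
    using invol by (rule inj_on_inverseI)
  ultimately show thesis
    using that[of m] mate subsetD[OF ME m] by simp
qed

lemma perfect_matching_card_eq: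
  assumes "bipartition V E A B" "perfect_matching V E M"
  shows "card A = card B"
proof -
  obtain m where m: "\<forall>v w. {v, w} \<in> M \<longrightarrow> m v = w" "\<forall>v\<in>V. {v, m v} \<in> E"
    "inj_on m V" "m ` A = B"
    by (rule perfect_matching_mate[OF assms])
  have "A \<subseteq> V"
    using assms unfolding bipartition_def by blast
  then have "inj_on m A"
    using m(3) by (rule inj_on_subset[rotated])
  then show ?thesis
    using card_image m(4) by fastforce
qed

lemma perfect_matching_card_le_vertex_cover:
  assumes "finite V" and bip: "bipartition V E A B" and "perfect_matching V E M"
    and U: "vertex_cover V E U"
  shows "card A \<le> card U"
proof -
  obtain m where m: "\<forall>v w. {v, w} \<in> M \<longrightarrow> m v = w" "\<forall>v\<in>V. {v, m v} \<in> E"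
    "inj_on m V" "m ` A = B"
    by (rule perfect_matching_mate[OF bip assms(3)])
  have V: "V = A \<union> B" and disj: "A \<inter> B = {}"
    using bip unfolding bipartition_def by auto
  \<comment> \<open>\<open>f\<close> picks an end in \<open>U\<close> of the matching edge at
    \<open>a\<close>. A value \<open>a\<close> and a value \<open>m b\<close> never coincide, as
    they lie on opposite sides; otherwise injectivity of \<open>m\<close> decides.\<close>
  define f where "f a = (if a \<in> U then a else m a)" for a
  have "inj_on f A"
  proof (rule inj_onI)
    fix a b assume "a \<in> A" "b \<in> A" "f a = f b"
    moreover have "m a \<in> B" "m b \<in> B"
      using m(4) calculation by auto
    ultimately show "a = b"
      using m(3) V disj unfolding f_def inj_on_def by (auto split: if_splits)
  qed
  moreover have "f ` A \<subseteq> U"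
    using U m(2) V unfolding f_def vertex_cover_def by fastforce
  moreover have "finite U"
    using U \<open>finite V\<close> finite_subset unfolding vertex_cover_def by blast
  ultimately show ?thesis
    by (rule card_inj_on_le)
qed

text \<open>All guards move along their matching edges. One end of the attacked edge lies in
  \<open>A\<close>, and its guard crosses to the other end.\<close>

lemma perfect_matching_defense:
  assumes bip: "bipartition V E A B" and M: "perfect_matching V E M" "{v, w} \<in> M"
  shows "\<exists>\<phi>. defense V E A v w \<phi> \<and> \<phi> ` A = B"
proof -
  obtain m where m: "\<forall>v w. {v, w} \<in> M \<longrightarrow> m v = w" "\<forall>v\<in>V. {v, m v} \<in> E"
    "inj_on m V" "m ` A = B"
    by (rule perfect_matching_mate[OF bip M(1)])
  have V: "A \<subseteq> V" "B \<subseteq> V"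
    using bip unfolding bipartition_def by auto
  have "m v = w" "m w = v"
    using m(1) M(2) by (auto simp: insert_commute)
  moreover have "v \<in> A \<or> w \<in> A"
    using bipartition_edgeD[OF bip, of v w] M unfolding perfect_matching_def by blast
  ultimately have "defense V E A v w m"
    using m V unfolding defense_def closed_nbhd_def by (auto intro: inj_on_subset)
  then show ?thesis
    using m(4) by blast
qed

text \<open>Different attacks may be answered with different matchings, since each of them swaps
  \<open>A\<close> and \<open>B\<close>. A single matching, obtained from any edge, gives the lower
  bound.\<close>

theorem bipartite_evc_eq_vc:
  assumes "finite V" and bip: "bipartition V E A B" and "E \<noteq> {}"
    and pm: "\<And>e. e \<in> E \<Longrightarrow> \<exists>M. perfect_matching V E M \<and> e \<in> M"
  shows "evc V E = vc V E \<and> min_evc_class V E {A, B}"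
proof -
  obtain M where M: "perfect_matching V E M"
    using pm \<open>E \<noteq> {}\<close> by blast
  note bip' = bipartition_commute[OF bip]
  note lower = perfect_matching_card_le_vertex_cover[OF \<open>finite V\<close> bip M]
  have vc: "vc V E = card A"
    unfolding vc_def
    by (rule Least_equality) (use lower bipartition_vertex_cover[OF bip] in blast)+
  have "\<exists>\<phi>. defense V E U v w \<phi> \<and> \<phi> ` U \<in> {A, B}" if "U \<in> {A, B}" "{v, w} \<in> E" for U v w
    using that pm perfect_matching_defense[OF bip] perfect_matching_defense[OF bip'] by blast
  then have cls: "evc_class V E {A, B} (card A)"
    unfolding evc_class_def
    using bipartition_vertex_cover[OF bip] bipartition_vertex_cover[OF bip']
      perfect_matching_card_eq[OF bip M] by auto
  have "evc V E = card A"
    unfolding evc_def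
  proof (rule Least_equality)
    show "\<exists>\<U>. evc_class V E \<U> (card A)"
      using cls by blast
    \<comment> \<open>A class is nonempty, and any member is a vertex cover of cardinality
      \<open>n\<close>, to which \<open>lower\<close> applies.\<close>
    show "card A \<le> n" if "\<exists>\<U>. evc_class V E \<U> n" for n
      using that lower unfolding evc_class_def by (metis ex_in_conv)
  qed
  then show ?thesis
    using vc cls unfolding min_evc_class_def by simp
qed

section \<open>Alternate edges of a path\<close>

definition even_edges :: "'a list \<Rightarrow> 'a set set" where
  "even_edges p = {{p ! i, p ! Suc i} | i. Suc i < length p \<and> even i}"

definition odd_edges :: "'a list \<Rightarrow> 'a set set" where
  "odd_edges p = {{p ! i, p ! Suc i} | i. Suc i < length p \<and> odd i}"

lemma path_edges_eq_even_odd: "path_edges p = even_edges p \<union> odd_edges p"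
  unfolding path_edges_def even_edges_def odd_edges_def by blast

lemma even_edges_subset: "e \<in> even_edges p \<Longrightarrow> e \<subseteq> set p"
  unfolding even_edges_def by auto

text \<open>The even edges pair the positions as (0,1), (2,3), and so on; an even number of vertices
  makes the last pair complete.\<close>

lemma even_edges_unique:
  assumes "distinct p" "even (length p)" "v \<in> set p"
  shows "\<exists>!e. e \<in> even_edges p \<and> v \<in> e"
proof -
  obtain n where n: "n < length p" "v = p ! n"
    using assms(3) by (auto simp: in_set_conv_nth)
  \<comment> \<open>The first position of the pair containing \<open>n\<close>.\<close>
  define i where "i = 2 * (n div 2)"
  have i: "n = i \<or> n = Suc i" "even i"
    unfolding i_def by presburger+
  then have len: "Suc i < length p"
    using n(1) assms(2) by (metis Suc_lessI even_Suc)
  show ?thesis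
  proof (intro ex1I conjI)
    show "{p ! i, p ! Suc i} \<in> even_edges p"
      using i len unfolding even_edges_def by blast
    show "v \<in> {p ! i, p ! Suc i}"
      using i n by auto
    fix e assume "e \<in> even_edges p \<and> v \<in> e"
    then obtain j where j: "e = {p ! j, p ! Suc j}" "Suc j < length p" "even j" "v = p ! j \<or> v = p ! Suc j"
      unfolding even_edges_def by blast
    then have "n = j \<or> n = Suc j"
      using n assms(1) by (metis Suc_lessD nth_eq_iff_index_eq)
    then have "i = j"
      using i j(3) by auto
    then show "e = {p ! i, p ! Suc i}"
      using j by simp
  qed
qed

lemma internal_vertices_nth:
  assumes "distinct p"
  shows "v \<in> internal_vertices p \<longleftrightarrow> (\<exists>n. 0 < n \<and> Suc n < length p \<and> v = p ! n)"
proof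
  assume v: "v \<in> internal_vertices p"
  then obtain n where n: "n < length p" "v = p ! n"
    unfolding internal_vertices_def by (auto simp: in_set_conv_nth)
  then have "p \<noteq> []"
    by auto
  then have "n \<noteq> 0" "n \<noteq> length p - 1"
    using n v unfolding internal_vertices_def by (metis DiffD2 hd_conv_nth insertCI last_conv_nth)+
  then show "\<exists>n. 0 < n \<and> Suc n < length p \<and> v = p ! n"
    using n by (intro exI[of _ n]) auto
next
  assume "\<exists>n. 0 < n \<and> Suc n < length p \<and> v = p ! n"
  then obtain n where n: "0 < n" "Suc n < length p" "v = p ! n"
    by blast
  then have "p \<noteq> []"
    by auto
  then show "v \<in> internal_vertices p"
    using n assms unfolding internal_vertices_def
    by (auto simp: hd_conv_nth last_conv_nth nth_eq_iff_index_eq)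
qed

text \<open>An odd \<open>i\<close> is positive, which excludes the first vertex.
  \<open>Suc i\<close> is even while the last position is odd, which excludes the last one.\<close>

lemma odd_edges_subset:
  assumes "distinct p" "even (length p)" "e \<in> odd_edges p"
  shows "e \<subseteq> internal_vertices p"
proof -
  obtain i where i: "e = {p ! i, p ! Suc i}" "Suc i < length p" "odd i"
    using assms(3) unfolding odd_edges_def by blast
  then have "Suc (Suc i) < length p" "0 < i"
    using assms(2) by (metis Suc_lessI even_Suc, simp add: odd_pos)
  then show ?thesis
    using i internal_vertices_nth[OF assms(1)] by (auto intro: Suc_lessD)
qed

lemma odd_edges_unique:
  assumes "distinct p" "v \<in> internal_vertices p"
  shows "\<exists>!e. e \<in> odd_edges p \<and> v \<in> e"
proof -
  obtain n where n: "0 < n" "Suc n < length p" "v = p ! n"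
    using assms internal_vertices_nth by metis
  \<comment> \<open>The pairs are now (1,2), (3,4), and so on, hence the shift by one. The pair of
    an internal \<open>n\<close> fits into the list because \<open>Suc n\<close> is still a
    position.\<close>
  define i where "i = 2 * ((n - 1) div 2) + 1"
  have i: "n = i \<or> n = Suc i" "odd i"
    using n(1) unfolding i_def by presburger+
  then have len: "Suc i < length p"
    using n(2) by auto
  show ?thesis
  proof (intro ex1I conjI)
    show "{p ! i, p ! Suc i} \<in> odd_edges p"
      using i len unfolding odd_edges_def by blast
    show "v \<in> {p ! i, p ! Suc i}"
      using i n by auto
    fix e assume "e \<in> odd_edges p \<and> v \<in> e"
    then obtain j where j: "e = {p ! j, p ! Suc j}" "Suc j < length p" "odd j" "v = p ! j \<or> v = p ! Suc j"
      unfolding odd_edges_def by blast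
    then have "n = j \<or> n = Suc j"
      using n assms(1) by (metis Suc_lessD nth_eq_iff_index_eq)
    then have "i = j"
      using i j(3) by auto
    then show "e = {p ! i, p ! Suc i}"
      using j by simp
  qed
qed

section \<open>Perfect matchings of odd melon graphs\<close>

lemma melon_perfect_matching:
  assumes P: "melon_paths k s t P" and odd: "\<forall>p\<in>P. odd (path_length p)" and q: "q \<in> P"
  shows "perfect_matching (\<Union>p\<in>P. set p) (\<Union>p\<in>P. path_edges p)
    (even_edges q \<union> (\<Union>p\<in>P - {q}. odd_edges p))"
    (is "perfect_matching ?V ?E ?M")
proof -
  have path: "distinct p" "even (length p)" "set p = internal_vertices p \<union> {s, t}"
    "internal_vertices p \<inter> {s, t} = {}" if "p \<in> P" for p
  proof -
    have p: "p \<noteq> []" "distinct p" "hd p = s" "last p = t"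
      using P that unfolding melon_paths_def path_between_def by auto
    show "distinct p" "internal_vertices p \<inter> {s, t} = {}"
      using p unfolding internal_vertices_def by auto
    \<comment> \<open>\<open>path_length\<close> counts edges, so a path of odd length has an even
      number of vertices.\<close>
    show "even (length p)"
      using odd that p(1) unfolding path_length_def by (cases p) auto
    have "s \<in> set p" "t \<in> set p"
      using p hd_in_set last_in_set by metis+
    then show "set p = internal_vertices p \<union> {s, t}"
      using p unfolding internal_vertices_def by auto
  qed
  have disj: "internal_vertices p \<inter> internal_vertices p' = {}"
    if "p \<in> P" "p' \<in> P" "p \<noteq> p'" for p p'
    using P that unfolding melon_paths_def by blast
  have "\<exists>!e. e \<in> ?M \<and> v \<in> e" if v: "v \<in> ?V" for v
  proof (cases "v \<in> set q")
    case True
    \<comment> \<open>Odd edges of another path stay among its internal vertices, which avoid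
      \<open>s\<close>, \<open>t\<close> and the internal vertices of \<open>q\<close>, hence all of
      \<open>q\<close>.\<close>
    have "v \<notin> e" if "p \<in> P - {q}" "e \<in> odd_edges p" for p e
      using odd_edges_subset[of p e] path[of p] path[OF q] disj[of p q] that True q by blast
    then have "e \<in> ?M \<and> v \<in> e \<longleftrightarrow> e \<in> even_edges q \<and> v \<in> e" for e
      by blast
    then show ?thesis
      using even_edges_unique[OF path(1,2)[OF q] True] by simp
  next
    case False
    obtain p where p: "p \<in> P" "v \<in> set p"
      using v by blast
    \<comment> \<open>Both \<open>s\<close> and \<open>t\<close> lie on \<open>q\<close>, so
      \<open>v\<close> is neither. It is therefore internal to \<open>p\<close>, and by disjointness
      no other path can match it with an odd edge.\<close>
    have v_int: "v \<in> internal_vertices p"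
      using p path(3)[OF p(1)] path(3)[OF q] False by blast
    have "v \<notin> e" if "p' \<in> P" "p' \<noteq> p" "e \<in> odd_edges p'" for p' e
      using odd_edges_subset[of p' e] path(1,2)[of p'] disj[of p p'] that p(1) v_int by blast
    then have "e \<in> ?M \<and> v \<in> e \<longleftrightarrow> e \<in> odd_edges p \<and> v \<in> e" for e
      using even_edges_subset[of e q] False p by blast
    then show ?thesis
      using odd_edges_unique[OF path(1)[OF p(1)] v_int] by simp
  qed
  moreover have "?M \<subseteq> ?E"
    using q unfolding path_edges_eq_even_odd by blast
  ultimately show ?thesis
    unfolding perfect_matching_def by (intro conjI ballI)
qed

theorem theorem9:
  fixes V A B :: "'a set" and E :: "'a set set" and k :: nat
  assumes "k \<ge> 3"
    and "odd_melon_graph k V E"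
    and "bipartition V E A B"
  shows "evc V E = vc V E \<and> min_evc_class V E {A, B}"
proof -
  obtain s t P where P: "melon_paths k s t P" "\<forall>p\<in>P. odd (path_length p)"
    and V: "V = (\<Union>p\<in>P. set p)" and E: "E = (\<Union>p\<in>P. path_edges p)"
    using assms(2) unfolding odd_melon_graph_def by blast
  have card: "card P \<ge> 2"
    using P(1) assms(1) unfolding melon_paths_def by simp
  show ?thesis
  proof (rule bipartite_evc_eq_vc)
    show "finite V"
      using melon_graph_simple[OF odd_melon_graph_imp_melon_graph[OF assms(2)]]
      unfolding simple_graph_def by blast
    show "bipartition V E A B"
      by (rule assms(3))
    obtain p where p: "p \<in> P"
      using card by fastforce
    then have "Suc 0 < length p"
      using P(1) unfolding melon_paths_def path_length_def by fastforce
    then show "E \<noteq> {}"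
      using p unfolding E path_edges_def by blast
  next
    fix e assume "e \<in> E"
    then obtain p where p: "p \<in> P" "e \<in> even_edges p \<or> e \<in> odd_edges p"
      unfolding E path_edges_eq_even_odd by blast
    \<comment> \<open>An odd edge of \<open>p\<close> belongs to the matching built from any other
      path \<open>q\<close>, so a second path is required; an even edge belongs to the one built
      from \<open>p\<close>.\<close>
    have "\<not> P \<subseteq> {p}"
      using card card_mono[of "{p}" P] by auto
    then obtain q where "q \<in> P" "q \<noteq> p"
      by blast
    then show "\<exists>M. perfect_matching V E M \<and> e \<in> M"
      using p melon_perfect_matching[OF P] unfolding V E by blast
  qed
qed

end
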